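(* For every integer $r>1$, the set $B_r=\{\Gamma\in\mathcal{VS}\mid \Gamma^{(r)}=\Gamma\}$ of virtual strings fixed by the $r$-covering map is infinite.
   Context: Nanowords. A Gauss word is a finite word (possibly empty) in which each letter appears exactly twice or not at all. A nanoword is a Gauss word together with a map $X\mapsto|X|\in\{a,b\}$ from its letters to $\{a,b\}$ ($|X|$ is the type of $X$). An isomorphism of nanowords is a type-preserving relabelling of letters which carries the $k$th letter of one word to the $k$th letter of the other for all $k$. Two nanowords are homotopic if related by a finite sequence of isomorphisms and the following moves and their inverses ($x,y,z,t$ are arbitrary sequences of letters such that both sides are Gauss words, types of letters being unchanged unless stated): shift: $AxAy\leftrightarrow xA'yA'$ where $|A'|\neq|A|$; H1: $xAAy\leftrightarrow xy$; H2: $xAByBAz\leftrightarrow xyz$ where $|A|\ne|B|$; H3: $xAByACzBCt\leftrightarrow xBAyCAzCBt$ where $|A|=|B|=|C|$. Virtual strings. A virtual string is (equivalently to its definition via planar diagrams with real and virtual crossings modulo flattened Reidemeister-type moves) a homotopy class of nanowords; $\mathcal{VS}$ is the set of all of them. A nanoword represents its class. Linking. Let $\alpha$ be a nanoword. Distinct letters $A,B$ are linked if they alternate in $\alpha$. Set $l(A,B)=0$ if $A=B$ or $A,B$ are not linked. If they occur in the order $\dots A\dots B\dots A\dots B\dots$, set $l(A,B)=1$ if $|A|=|B|$ and $-1$ otherwise; if in the order $\dots B\dots A\dots B\dots A\dots$, set $l(A,B)=-1$ if $|A|=|B|$ and $1$ otherwise. Put $n(X)=\sum_{Y\in\alpha}l(X,Y)$,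 the sum over all letters $Y$ of $\alpha$. Coverings. For a non-negative integer $r$, the $r$-covering $\alpha^{(r)}$ of $\alpha$ is obtained by deleting from $\alpha$ (both occurrences of) every letter $X$ for which $n(X)$ (computed in $\alpha$) is not divisible by $r$ (for $r=0$: delete every $X$ with $n(X)\neq0$). It is known that homotopic nanowords have homotopic $r$-coverings, so for a virtual string $\Gamma$ represented by $\alpha$, $\Gamma^{(r)}$ is defined as the virtual string represented by $\alpha^{(r)}$. *)

theory Defs
  imports Main
begin

datatype letter_type = Type_a | Type_b

text \<open>
  A nanoword is a word over the countably infinite alphabet \<^typ>\<open>nat\<close> together with the types of
  its letters.  The values of the type map at letters that do not occur in the word carry no
  information: they are changed freely by the isomorphism move below.
\<close>

type_synonym nanoword = "nat list \<times> (nat \<Rightarrow> letter_type)"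

definition gauss_word :: "nat list \<Rightarrow> bool" where
  "gauss_word w \<longleftrightarrow> (\<forall>A. count_list w A = 0 \<or> count_list w A = 2)"

inductive move :: "nanoword \<Rightarrow> nanoword \<Rightarrow> bool" where
  iso: "\<lbrakk>gauss_word w; inj_on f (set w); \<forall>A\<in>set w. t' (f A) = t A\<rbrakk>
    \<Longrightarrow> move (w, t) (map f w, t')"
| shift: "\<lbrakk>gauss_word ([A] @ x @ [A] @ y); gauss_word (x @ [A'] @ y @ [A']);
     t' A' \<noteq> t A; \<forall>B\<in>set x \<union> set y. t' B = t B\<rbrakk>
    \<Longrightarrow> move ([A] @ x @ [A] @ y, t) (x @ [A'] @ y @ [A'], t')"
| H1: "\<lbrakk>gauss_word (x @ [A, A] @ y); gauss_word (x @ y)\<rbrakk>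
    \<Longrightarrow> move (x @ [A, A] @ y, t) (x @ y, t)"
| H2: "\<lbrakk>gauss_word (x @ [A, B] @ y @ [B, A] @ z); gauss_word (x @ y @ z); t A \<noteq> t B\<rbrakk>
    \<Longrightarrow> move (x @ [A, B] @ y @ [B, A] @ z, t) (x @ y @ z, t)"
| H3: "\<lbrakk>gauss_word (x @ [A, B] @ y @ [A, C] @ z @ [B, C] @ u);
     gauss_word (x @ [B, A] @ y @ [C, A] @ z @ [C, B] @ u); t A = t B; t B = t C\<rbrakk>
    \<Longrightarrow> move (x @ [A, B] @ y @ [A, C] @ z @ [B, C] @ u, t)
             (x @ [B, A] @ y @ [C, A] @ z @ [C, B] @ u, t)"

definition homotopic :: "nanoword \<Rightarrow> nanoword \<Rightarrow> bool" where
  "homotopic \<alpha> \<beta> \<longleftrightarrow> gauss_word (fst \<alpha>) \<and> gauss_word (fst \<beta>) \<and> equivclp move \<alpha> \<beta>"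

text \<open>\<open>homotopic\<close> is a partial equivalence relation whose domain consists of the nanowords.\<close>

quotient_type virtual_string = nanoword / partial: homotopic
proof (rule part_equivpI)
  have "gauss_word []" by (simp add: gauss_word_def)
  then show "\<exists>\<alpha>. homotopic \<alpha> \<alpha>"
    by (intro exI[of _ "([], \<lambda>_. Type_a)"]) (simp add: homotopic_def)
  show "symp homotopic"
    by (auto intro!: sympI simp: homotopic_def intro: equivclp_sym)
  show "transp homotopic"
    by (auto intro!: transpI simp: homotopic_def intro: equivclp_trans)
qed

definition alternate :: "nat list \<Rightarrow> nat \<Rightarrow> nat \<Rightarrow> bool" where
  "alternate w A B \<longleftrightarrow> A \<noteq> B \<and> filter (\<lambda>X. X = A \<or> X = B) w = [A, B, A, B]"

definition link :: "nanoword \<Rightarrow> nat \<Rightarrow> nat \<Rightarrow> int" where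
  "link \<alpha> A B =
    (if alternate (fst \<alpha>) A B then (if snd \<alpha> A = snd \<alpha> B then 1 else -1)
     else if alternate (fst \<alpha>) B A then (if snd \<alpha> A = snd \<alpha> B then -1 else 1)
     else 0)"

definition n_index :: "nanoword \<Rightarrow> nat \<Rightarrow> int" where
  "n_index \<alpha> X = (\<Sum>Y\<in>set (fst \<alpha>). link \<alpha> X Y)"

text \<open>Divisibility by \<open>0\<close> means being equal to \<open>0\<close>, so the case \<open>r = 0\<close> needs no special treatment.\<close>

definition cover :: "nat \<Rightarrow> nanoword \<Rightarrow> nanoword" where
  "cover r \<alpha> = (filter (\<lambda>X. int r dvd n_index \<alpha> X) (fst \<alpha>), snd \<alpha>)"

subsection \<open>Homotopic nanowords have homotopic coverings\<close>

lemma count_list_filter: "count_list (filter P w) A = (if P A then count_list w A else 0)"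
  by (induction w) auto

lemma gauss_filter: "gauss_word w \<Longrightarrow> gauss_word (filter P w)"
  by (auto simp: gauss_word_def count_list_filter)

lemma gauss_cover: "gauss_word (fst \<alpha>) \<Longrightarrow> gauss_word (fst (cover r \<alpha>))"
  by (simp add: cover_def gauss_filter)

lemma filter_pair:
  "A \<notin> set x \<Longrightarrow> filter (\<lambda>Z. Z = X \<or> Z = A) x = replicate (count_list x X) X"
  "A \<notin> set x \<Longrightarrow> filter (\<lambda>Z. Z = A \<or> Z = X) x = replicate (count_list x X) X"
  by (induction x, auto)+

lemma gauss_map:
  assumes "gauss_word w" "inj_on f (set w)"
  shows "gauss_word (map f w)"
  unfolding gauss_word_def
proof
  fix B
  show "count_list (map f w) B = 0 \<or> count_list (map f w) B = 2"
  proof (cases "B \<in> f ` set w")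
    case True
    then obtain A where A: "A \<in> set w" "B = f A" by auto
    have "count_list (map f l) (f A) = count_list l A" if "set l \<subseteq> set w" for l
      using that
    proof (induction l)
      case (Cons B l)
      then have "f B = f A \<longleftrightarrow> B = A" using A(1) assms(2) by (auto simp: inj_on_eq_iff)
      with Cons show ?case by simp
    qed simp
    then show ?thesis using A(2) assms(1) by (simp add: gauss_word_def)
  next
    case False
    then show ?thesis by (auto simp: count_list_0_iff)
  qed
qed

lemma move_gauss: "move \<alpha> \<beta> \<Longrightarrow> gauss_word (fst \<alpha>) \<and> gauss_word (fst \<beta>)"
  by (induction rule: move.induct) (auto simp: gauss_map)

lemma link_map:
  assumes "inj_on f (set w)" "\<forall>A\<in>set w. t' (f A) = t A" "A \<in> set w" "B \<in> set w"
  shows "link (map f w, t') (f A) (f B) = link (w, t) A B"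
proof -
  have alt: "alternate (map f w) (f A) (f B) = alternate w A B"
    if "A \<in> set w" "B \<in> set w" for A B
  proof -
    have "filter (\<lambda>X. X = f A \<or> X = f B) (map f w) = map f (filter (\<lambda>X. X = A \<or> X = B) w)"
      unfolding filter_map comp_def
      using that assms(1) by (intro arg_cong[of _ _ "map f"] filter_cong) (auto simp: inj_on_def)
    moreover have "map f (filter (\<lambda>X. X = A \<or> X = B) w) = map f [A,B,A,B]
       \<longleftrightarrow> filter (\<lambda>X. X = A \<or> X = B) w = [A,B,A,B]"
      using that assms(1) by (intro inj_on_map_eq_map) (auto simp: inj_on_def)
    ultimately show ?thesis
      using that assms(1) by (auto simp: alternate_def inj_on_eq_iff)
  qed
  show ?thesis using assms by (simp add: link_def alt)
qed

lemma cover_iso: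
  assumes "gauss_word w" "inj_on f (set w)" "\<forall>A\<in>set w. t' (f A) = t A"
  shows "move (cover r (w, t)) (cover r (map f w, t'))"
proof -
  have n: "n_index (map f w, t') (f A) = n_index (w, t) A" if "A \<in> set w" for A
    using assms(2) link_map[OF assms(2,3) that] by (simp add: n_index_def sum.reindex)
  have "filter (\<lambda>X. int r dvd n_index (map f w, t') X) (map f w)
      = map f (filter (\<lambda>X. int r dvd n_index (w, t) X) w)"
    unfolding filter_map comp_def
    by (intro arg_cong[of _ _ "map f"] filter_cong) (auto simp: n)
  then show ?thesis
    using assms by (auto simp: cover_def intro!: move.iso gauss_filter intro: inj_on_subset)
qed

lemma count_list_two:
  "gauss_word w \<Longrightarrow> X \<in> set w \<Longrightarrow> count_list w X = 2"
  unfolding gauss_word_def by (metis count_list_0_iff)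

lemma link_cong:
  assumes "filter (\<lambda>Z. Z = X \<or> Z = Y) v = filter (\<lambda>Z. Z = X \<or> Z = Y) w" "s X = t X" "s Y = t Y"
  shows "link (v, s) X Y = link (w, t) X Y"
proof -
  have "filter (\<lambda>Z. Z = Y \<or> Z = X) v = filter (\<lambda>Z. Z = Y \<or> Z = X) w"
    using assms(1) by (simp add: disj_commute)
  then show ?thesis using assms by (simp add: link_def alternate_def)
qed

lemma move_refl: "gauss_word w \<Longrightarrow> (\<forall>A\<in>set w. t' A = t A) \<Longrightarrow> move (w, t) (w, t')"
  using move.iso[of w id t' t] by simp

lemma link_self: "link \<alpha> X X = 0"
  by (simp add: link_def alternate_def)

lemma sum_two_cases:
  fixes i j :: nat
  assumes "i + j = 2"
  obtains "i = 0" "j = 2" | "i = 1" "j = 1" | "i = 2" "j = 0"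
  using assms by arith

lemma cover_shift:
  assumes g: "gauss_word ([A] @ x @ [A] @ y)" and g': "gauss_word (x @ [A'] @ y @ [A'])"
    and tA: "t' A' \<noteq> t A" and tt: "\<forall>B\<in>set x \<union> set y. t' B = t B"
  shows "equivclp move (cover r ([A] @ x @ [A] @ y, t)) (cover r (x @ [A'] @ y @ [A'], t'))"
proof -
  note [[linarith_neq_limit = 0]]
  let ?w = "[A] @ x @ [A] @ y" and ?w' = "x @ [A'] @ y @ [A']"
  have "count_list ?w A = 2" using count_list_two[OF g, of A] by simp
  then have A: "A \<notin> set x" "A \<notin> set y" by (auto simp: count_list_0_iff)
  have "count_list ?w' A' = 2" using count_list_two[OF g', of A'] by simp
  then have A': "A' \<notin> set x" "A' \<notin> set y" by (auto simp: count_list_0_iff)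
  have lA: "link (?w', t') A' Y = link (?w, t) A Y \<and> link (?w', t') Y A' = link (?w, t) Y A"
    if Y: "Y \<in> set x \<union> set y" for Y
  proof -
    have ne: "Y \<noteq> A" "Y \<noteq> A'" "A \<noteq> Y" "A' \<noteq> Y" using Y A A' by auto
    have "count_list ?w Y = 2" using count_list_two[OF g, of Y] Y by simp
    then have "count_list x Y + count_list y Y = 2" using ne by simp
    moreover have "t' A' = t' Y \<longleftrightarrow> t A \<noteq> t Y" "t' Y = t' A' \<longleftrightarrow> t Y \<noteq> t A"
      using tt Y tA by (metis UnCI letter_type.exhaust Un_iff)+
    ultimately show ?thesis
      using ne A A'
      by (elim sum_two_cases) (simp_all add: link_def alternate_def filter_pair numeral_2_eq_2)
  qed
  have lXY: "link (?w', t') X Y = link (?w, t) X Y" if "X \<in> set x \<union> set y" "Y \<in> set x \<union> set y" for X Y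
    using that A A' tt by (intro link_cong) auto
  have n: "n_index (?w, t) X = link (?w, t) X A + (\<Sum>Y\<in>set x \<union> set y. link (?w, t) X Y)" for X
    using A by (simp add: n_index_def)
  have n': "n_index (?w', t') X = link (?w', t') X A' + (\<Sum>Y\<in>set x \<union> set y. link (?w', t') X Y)" for X
    using A' by (simp add: n_index_def)
  have nX: "n_index (?w', t') X = n_index (?w, t) X" if "X \<in> set x \<union> set y" for X
    unfolding n n' using that by (simp add: lA lXY del: append.simps)
  have nA: "n_index (?w', t') A' = n_index (?w, t) A"
    unfolding n n' by (simp add: lA link_self del: append.simps)
  define P where "P X \<longleftrightarrow> int r dvd n_index (?w, t) X" for X
  define P' where "P' X \<longleftrightarrow> int r dvd n_index (?w', t') X" for X
  have PA: "P' A' = P A" by (simp only: P_def P'_def nA)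
  have PX: "filter P' x = filter P x" "filter P' y = filter P y"
    by (auto simp: P_def P'_def nX simp del: append.simps intro!: filter_cong)
  have c: "cover r (?w, t) = (filter P ?w, t)" "cover r (?w', t') = (filter P' ?w', t')"
    by (simp_all add: cover_def P_def[abs_def] P'_def[abs_def])
  have G: "gauss_word (filter P ?w)" "gauss_word (filter P' ?w')"
    using gauss_filter[OF g] gauss_filter[OF g'] by auto
  show ?thesis
  proof (cases "P A")
    case True
    have "move ([A] @ filter P x @ [A] @ filter P y, t) (filter P x @ [A'] @ filter P y @ [A'], t')"
      using G True PA PX tA tt by (intro move.shift) auto
    then show ?thesis
      using True PA by (auto simp: c PX simp del: append.simps)
  next
    case False
    have "move (filter P x @ filter P y, t) (filter P x @ filter P y, t')"
      using G False PA tt by (intro move_refl) auto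
    then show ?thesis
      using False PA by (auto simp: c PX simp del: append_Cons)
  qed
qed

lemma cover_H1:
  assumes g: "gauss_word (x @ [A, A] @ y)" and g': "gauss_word (x @ y)"
  shows "equivclp move (cover r (x @ [A, A] @ y, t)) (cover r (x @ y, t))"
proof -
  note [[linarith_neq_limit = 0]]
  let ?w = "x @ [A, A] @ y" and ?w' = "x @ y"
  have "count_list ?w A = 2" using count_list_two[OF g, of A] by simp
  then have A: "A \<notin> set x" "A \<notin> set y" by (auto simp: count_list_0_iff)
  have lA: "link (?w, t) X A = 0" if X: "X \<in> set x \<union> set y" for X
  proof -
    have ne: "X \<noteq> A" using X A by auto
    have "count_list ?w X = 2" using count_list_two[OF g, of X] X by simp
    then have "count_list x X + count_list y X = 2" using ne by simp
    then show ?thesis using ne A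
      by (elim sum_two_cases) (simp_all add: link_def alternate_def filter_pair numeral_2_eq_2)
  qed
  have lXY: "link (?w', t) X Y = link (?w, t) X Y" if "X \<in> set x \<union> set y" "Y \<in> set x \<union> set y" for X Y
    using that A by (intro link_cong) auto
  have "set ?w = insert A (set x \<union> set y)" by auto
  then have n: "n_index (?w, t) X = link (?w, t) X A + (\<Sum>Y\<in>set x \<union> set y. link (?w, t) X Y)" for X
    using A by (simp add: n_index_def)
  have n': "n_index (?w', t) X = (\<Sum>Y\<in>set x \<union> set y. link (?w', t) X Y)" for X
    by (simp add: n_index_def)
  have nX: "n_index (?w', t) X = n_index (?w, t) X" if "X \<in> set x \<union> set y" for X
    unfolding n n' using lA[OF that] by (simp only: add_0 lXY[OF that] cong: sum.cong)
  define P where "P X \<longleftrightarrow> int r dvd n_index (?w, t) X" for X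
  define P' where "P' X \<longleftrightarrow> int r dvd n_index (?w', t) X" for X
  have PX: "filter P' x = filter P x" "filter P' y = filter P y"
    by (auto simp: P_def P'_def nX simp del: append.simps intro!: filter_cong)
  have c: "cover r (?w, t) = (filter P ?w, t)" "cover r (?w', t) = (filter P' ?w', t)"
    by (simp_all add: cover_def P_def[abs_def] P'_def[abs_def])
  have G: "gauss_word (filter P ?w)" "gauss_word (filter P' ?w')"
    using gauss_filter[OF g] gauss_filter[OF g'] by auto
  show ?thesis
  proof (cases "P A")
    case True
    have "move (filter P x @ [A, A] @ filter P y, t) (filter P x @ filter P y, t)"
      using G True PX by (intro move.H1) auto
    then show ?thesis using True by (auto simp: c PX simp del: append.simps)
  qed (simp add: c PX del: append_Cons)
qed

lemma sum_three_cases: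
  fixes i j k :: nat
  assumes "i + j + k = 2"
  obtains "i = 0" "j = 0" "k = 2" | "i = 0" "j = 1" "k = 1" | "i = 0" "j = 2" "k = 0"
    | "i = 1" "j = 0" "k = 1" | "i = 1" "j = 1" "k = 0" | "i = 2" "j = 0" "k = 0"
proof -
  consider "i = 0" "j + k = 2" | "i = 1" "j + k = 1" | "i = 2" "j + k = 0"
    using assms by arith
  then show thesis
    using that by cases (auto simp: add_is_1 elim!: sum_two_cases)
qed

lemma cover_H2:
  assumes g: "gauss_word (x @ [A, B] @ y @ [B, A] @ z)" and g': "gauss_word (x @ y @ z)"
    and tAB: "t A \<noteq> t B"
  shows "equivclp move (cover r (x @ [A, B] @ y @ [B, A] @ z, t)) (cover r (x @ y @ z, t))"
proof -
  note [[linarith_neq_limit = 0]]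
  let ?w = "x @ [A, B] @ y @ [B, A] @ z" and ?w' = "x @ y @ z"
  let ?S = "set x \<union> set y \<union> set z"
  have AB: "A \<noteq> B" using tAB by auto
  have "count_list ?w A = 2" using count_list_two[OF g, of A] by simp
  then have A: "A \<notin> set x" "A \<notin> set y" "A \<notin> set z" using AB by (auto simp: count_list_0_iff)
  have "count_list ?w B = 2" using count_list_two[OF g, of B] by simp
  then have B: "B \<notin> set x" "B \<notin> set y" "B \<notin> set z" using AB by (auto simp: count_list_0_iff)
  have lA: "link (?w, t) X B = - link (?w, t) X A \<and> link (?w, t) B X = - link (?w, t) A X"
    if X: "X \<in> ?S" for X
  proof -
    have ne: "X \<noteq> A" "X \<noteq> B" "A \<noteq> X" "B \<noteq> X" using X A B by auto
    have "count_list ?w X = 2" using count_list_two[OF g, of X] X by simp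
    then have "count_list x X + count_list y X + count_list z X = 2" using ne by (simp add: add.assoc)
    moreover have "t B = t X \<longleftrightarrow> t A \<noteq> t X" "t X = t B \<longleftrightarrow> t X \<noteq> t A"
      using tAB by (metis letter_type.exhaust)+
    ultimately show ?thesis using ne A B AB
      by (elim sum_three_cases) (simp_all add: link_def alternate_def filter_pair numeral_2_eq_2)
  qed
  have lAB: "link (?w, t) A B = 0" "link (?w, t) B A = 0"
    using A B AB by (simp_all add: link_def alternate_def filter_pair)
  have lXY: "link (?w', t) X Y = link (?w, t) X Y" if "X \<in> ?S" "Y \<in> ?S" for X Y
    using that A B by (intro link_cong) auto
  have "set ?w = insert A (insert B ?S)" by auto
  then have n: "n_index (?w, t) X = link (?w, t) X A + link (?w, t) X B + (\<Sum>Y\<in>?S. link (?w, t) X Y)" for X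
    using A B AB by (simp add: n_index_def)
  have n': "n_index (?w', t) X = (\<Sum>Y\<in>?S. link (?w', t) X Y)" for X
    by (simp add: n_index_def Un_assoc)
  have nX: "n_index (?w', t) X = n_index (?w, t) X" if "X \<in> ?S" for X
    unfolding n n' using that lA[OF that] by (simp add: lXY del: append.simps)
  have nAB: "n_index (?w, t) B = - n_index (?w, t) A"
    unfolding n by (simp add: lAB link_self lA sum_negf del: append.simps)
  define P where "P X \<longleftrightarrow> int r dvd n_index (?w, t) X" for X
  define P' where "P' X \<longleftrightarrow> int r dvd n_index (?w', t) X" for X
  have PA: "P B = P A" unfolding P_def nAB by (simp only: dvd_minus_iff)
  have PX: "filter P' x = filter P x" "filter P' y = filter P y" "filter P' z = filter P z"
    by (auto simp: P_def P'_def nX simp del: append.simps intro!: filter_cong)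
  have c: "cover r (?w, t) = (filter P ?w, t)" "cover r (?w', t) = (filter P' ?w', t)"
    by (simp_all add: cover_def P_def[abs_def] P'_def[abs_def])
  have G: "gauss_word (filter P ?w)" "gauss_word (filter P' ?w')"
    using gauss_filter[OF g] gauss_filter[OF g'] by auto
  show ?thesis
  proof (cases "P A")
    case True
    have "move (filter P x @ [A, B] @ filter P y @ [B, A] @ filter P z, t)
               (filter P x @ filter P y @ filter P z, t)"
      using G True PA PX tAB by (intro move.H2) auto
    then show ?thesis using True PA by (auto simp: c PX simp del: append.simps)
  qed (simp add: c PX PA del: append_Cons)
qed

lemma sum_four_cases:
  fixes i j k m :: nat
  assumes "i + j + k + m = 2"
  obtains "i = 0" "j = 0" "k = 0" "m = 2" | "i = 0" "j = 0" "k = 1" "m = 1"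
    | "i = 0" "j = 0" "k = 2" "m = 0" | "i = 0" "j = 1" "k = 0" "m = 1"
    | "i = 0" "j = 1" "k = 1" "m = 0" | "i = 0" "j = 2" "k = 0" "m = 0"
    | "i = 1" "j = 0" "k = 0" "m = 1" | "i = 1" "j = 0" "k = 1" "m = 0"
    | "i = 1" "j = 1" "k = 0" "m = 0" | "i = 2" "j = 0" "k = 0" "m = 0"
proof -
  consider "m = 0" "i + j + k = 2" | "m = 1" "i + j + k = 1" | "m = 2" "i + j + k = 0"
    using assms by arith
  then show thesis
  proof cases
    case 1
    from 1(2) show thesis by (rule sum_three_cases) (use 1(1) that in blast)+
  next
    case 2
    then consider "i = 1" "j = 0" "k = 0" | "i = 0" "j = 1" "k = 0" | "i = 0" "j = 0" "k = 1"
      by (auto simp: add_is_1)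
    then show thesis by cases (use 2(1) that in blast)+
  next
    case 3
    then show thesis using that(1) by simp
  qed
qed

lemma cover_H3:
  assumes g: "gauss_word (x @ [A, B] @ y @ [A, C] @ z @ [B, C] @ u)"
    and g': "gauss_word (x @ [B, A] @ y @ [C, A] @ z @ [C, B] @ u)"
    and tAB: "t A = t B" and tBC: "t B = t C"
  shows "equivclp move (cover r (x @ [A, B] @ y @ [A, C] @ z @ [B, C] @ u, t))
     (cover r (x @ [B, A] @ y @ [C, A] @ z @ [C, B] @ u, t))"
proof -
  note [[linarith_neq_limit = 0]]
  let ?w = "x @ [A, B] @ y @ [A, C] @ z @ [B, C] @ u"
  let ?w' = "x @ [B, A] @ y @ [C, A] @ z @ [C, B] @ u"
  let ?S = "set x \<union> set y \<union> set z \<union> set u"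
  have cA: "count_list ?w A = 2" using count_list_two[OF g, of A] by simp
  have cB: "count_list ?w B = 2" using count_list_two[OF g, of B] by simp
  have cC: "count_list ?w C = 2" using count_list_two[OF g, of C] by simp
  have ne: "A \<noteq> B" "A \<noteq> C" "B \<noteq> C" using cA cB cC by (auto split: if_splits)
  have A: "A \<notin> set x" "A \<notin> set y" "A \<notin> set z" "A \<notin> set u"
    using cA ne by (auto simp: count_list_0_iff)
  have B: "B \<notin> set x" "B \<notin> set y" "B \<notin> set z" "B \<notin> set u"
    using cB ne by (auto simp: count_list_0_iff)
  have C: "C \<notin> set x" "C \<notin> set y" "C \<notin> set z" "C \<notin> set u"
    using cC ne by (auto simp: count_list_0_iff)
  have l1: "link (?w, t) B X = link (?w, t) A X + link (?w, t) C X"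
    if X: "X \<in> ?S" for X
  proof -
    have ne2: "X \<noteq> A" "X \<noteq> B" "X \<noteq> C" "A \<noteq> X" "B \<noteq> X" "C \<noteq> X" using X A B C by auto
    have "count_list ?w X = 2" using count_list_two[OF g, of X] X by simp
    then have "count_list x X + count_list y X + count_list z X + count_list u X = 2"
      using ne2 by (simp add: add.assoc)
    then show ?thesis using ne ne2 A B C tAB tBC
      by (elim sum_four_cases) (simp_all add: link_def alternate_def filter_pair numeral_2_eq_2)
  qed
  have l2: "link (?w', t) X Y = link (?w, t) X Y" if "X \<in> ?S \<or> Y \<in> ?S" for X Y
    using that A B C by (intro link_cong) auto
  have l3: "link (?w, t) A B = 1" "link (?w, t) A C = 0" "link (?w, t) B A = -1"
     "link (?w, t) B C = 1" "link (?w, t) C A = 0" "link (?w, t) C B = -1"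
    using A B C ne tAB tBC by (simp_all add: link_def alternate_def filter_pair)
  have l4: "link (?w', t) A B = 0" "link (?w', t) A C = 1" "link (?w', t) B A = 0"
     "link (?w', t) B C = 0" "link (?w', t) C A = -1" "link (?w', t) C B = 0"
    using A B C ne tAB tBC by (simp_all add: link_def alternate_def filter_pair)
  have "set ?w = insert A (insert B (insert C ?S))" "set ?w' = insert A (insert B (insert C ?S))"
    by auto
  then have n: "n_index (?w, t) X = link (?w, t) X A + link (?w, t) X B + link (?w, t) X C
          + (\<Sum>Y\<in>?S. link (?w, t) X Y)"
    and n': "n_index (?w', t) X = link (?w', t) X A + link (?w', t) X B + link (?w', t) X C
          + (\<Sum>Y\<in>?S. link (?w', t) X Y)" for X
    using A B C ne by (simp_all add: n_index_def)
  have nX: "n_index (?w', t) X = n_index (?w, t) X" if "X \<in> ?S" for X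
    unfolding n n' using that by (simp add: l2 del: append.simps)
  have nABC: "n_index (?w', t) A = n_index (?w, t) A" "n_index (?w', t) B = n_index (?w, t) B"
    "n_index (?w', t) C = n_index (?w, t) C"
    unfolding n n' by (simp_all add: l2 l3 l4 link_self del: append.simps)
  have nB: "n_index (?w, t) B = n_index (?w, t) A + n_index (?w, t) C"
    unfolding n by (simp add: l1 l3 link_self sum.distrib del: append.simps)
  define P where "P X \<longleftrightarrow> int r dvd n_index (?w, t) X" for X
  define P' where "P' X \<longleftrightarrow> int r dvd n_index (?w', t) X" for X
  have PABC: "P' A = P A" "P' B = P B" "P' C = P C" by (simp_all only: P_def P'_def nABC)
  have PB: "P A \<Longrightarrow> P B = P C" "P B \<Longrightarrow> P A = P C" "P C \<Longrightarrow> P A = P B"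
    unfolding P_def nB
    using dvd_add_right_iff[of "int r" "n_index (?w, t) A" "n_index (?w, t) C"]
      dvd_add_left_iff[of "int r" "n_index (?w, t) C" "n_index (?w, t) A"] by blast+
  have PX: "filter P' x = filter P x" "filter P' y = filter P y" "filter P' z = filter P z"
    "filter P' u = filter P u"
    by (auto simp: P_def P'_def nX simp del: append.simps intro!: filter_cong)
  have c: "cover r (?w, t) = (filter P ?w, t)" "cover r (?w', t) = (filter P' ?w', t)"
    by (simp_all add: cover_def P_def[abs_def] P'_def[abs_def])
  have G: "gauss_word (filter P ?w)" "gauss_word (filter P' ?w')"
    using gauss_filter[OF g] gauss_filter[OF g'] by auto
  show ?thesis
  proof (cases "P A \<and> P B \<and> P C")
    case True
    have "move (filter P x @ [A, B] @ filter P y @ [A, C] @ filter P z @ [B, C] @ filter P u, t)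
               (filter P x @ [B, A] @ filter P y @ [C, A] @ filter P z @ [C, B] @ filter P u, t)"
      using G True PABC PX tAB tBC by (intro move.H3) auto
    then show ?thesis using True by (auto simp: c PX PABC simp del: append.simps)
  next
    case False
    then consider "\<not> P A" "\<not> P B" | "\<not> P A" "\<not> P C" | "\<not> P B" "\<not> P C"
      using PB by blast
    then have "filter P' ?w' = filter P ?w"
      by cases (simp_all add: PX PABC)
    then show ?thesis by (simp only: c equivclp_refl)
  qed
qed

lemma cover_move: "move \<alpha> \<beta> \<Longrightarrow> equivclp move (cover r \<alpha>) (cover r \<beta>)"
proof (induction rule: move.induct)
  case (iso w f t' t)
  then show ?case by (intro r_into_equivclp cover_iso)
next
  case shift
  then show ?case by (rule cover_shift)
next
  case H1
  then show ?case by (rule cover_H1)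
next
  case H2
  then show ?case by (rule cover_H2)
next
  case H3
  then show ?case by (rule cover_H3)
qed

lemma cover_homotopic:
  assumes "homotopic \<alpha> \<beta>"
  shows "homotopic (cover r \<alpha>) (cover r \<beta>)"
proof -
  have "equivclp move (cover r \<alpha>) (cover r \<beta>)" if "equivclp move \<alpha> \<beta>"
    using that
  proof (induction rule: equivclp_induct)
    case (step \<beta> \<gamma>)
    from step.hyps(2) have "equivclp move (cover r \<beta>) (cover r \<gamma>)"
      by (elim disjE) (rule cover_move, assumption, rule equivclp_sym[OF cover_move], assumption)
    with step.IH show ?case by (rule equivclp_trans)
  qed simp
  with assms show ?thesis by (simp add: homotopic_def gauss_cover)
qed

lift_definition covering :: "nat \<Rightarrow> virtual_string \<Rightarrow> virtual_string" is cover
  by (rule cover_homotopic)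

end

theory Submission
  imports Defs
begin

text \<open>
  Under the shift move and H3 the indices \<open>n(X)\<close> of the letters are preserved, H1 removes a letter of
  index 0, and H2 removes two letters of opposite indices.  Hence the sum of \<open>h (n(X))\<close> over all
  letters is a homotopy invariant for every odd function \<open>h\<close>; this is Turaev's \<open>u\<close>-polynomial.
  A word of \<open>p\<close> pairwise unlinked letters, each linked in the same direction to each of \<open>q\<close> further
  pairwise unlinked letters, has indices \<open>q\<close> (\<open>p\<close> times) and \<open>-p\<close> (\<open>q\<close> times).  For \<open>p = r\<close> and \<open>q\<close>
  running over the multiples of \<open>r\<close> other than \<open>r\<close>, it equals its own \<open>r\<close>-covering, while the
  invariant recovers \<open>q\<close>.
\<close>

section \<open>Homotopy invariants from odd functions of the indices\<close>

definition odd_index_sum :: "(int \<Rightarrow> int) \<Rightarrow> nanoword \<Rightarrow> int" where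
  "odd_index_sum h \<alpha> = (\<Sum>X\<in>set (fst \<alpha>). h (n_index \<alpha> X))"

lemma odd_index_sum_iso:
  assumes "inj_on f (set w)" "\<forall>A\<in>set w. t' (f A) = t A"
  shows "odd_index_sum h (map f w, t') = odd_index_sum h (w, t)"
proof -
  have "n_index (map f w, t') (f A) = n_index (w, t) A" if "A \<in> set w" for A
    using assms(1) link_map[OF assms that] by (simp add: n_index_def sum.reindex)
  then show ?thesis
    using assms(1) by (simp add: odd_index_sum_def sum.reindex)
qed

text \<open>Letters linked with \<open>A\<close> occur once in \<open>x\<close> and once in
  \<open>y\<close>, so moving \<open>A\<close> reverses the order of alternation. The change of type
  reverses the sign once more, so \<open>A'\<close> inherits all links of \<open>A\<close>, and no
  index changes.\<close>

lemma odd_index_sum_shift: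
  assumes g: "gauss_word ([A] @ x @ [A] @ y)" and g': "gauss_word (x @ [A'] @ y @ [A'])"
    and tA: "t' A' \<noteq> t A" and tt: "\<forall>B\<in>set x \<union> set y. t' B = t B"
  shows "odd_index_sum h (x @ [A'] @ y @ [A'], t') = odd_index_sum h ([A] @ x @ [A] @ y, t)"
proof -
  note [[linarith_neq_limit = 0]]
  let ?w = "[A] @ x @ [A] @ y" and ?w' = "x @ [A'] @ y @ [A']"
  let ?S = "set x \<union> set y"
  have "count_list ?w A = 2" using count_list_two[OF g, of A] by simp
  then have A: "A \<notin> set x" "A \<notin> set y" by (auto simp: count_list_0_iff)
  have "count_list ?w' A' = 2" using count_list_two[OF g', of A'] by simp
  then have A': "A' \<notin> set x" "A' \<notin> set y" by (auto simp: count_list_0_iff)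
  have lA: "link (?w', t') A' Y = link (?w, t) A Y \<and> link (?w', t') Y A' = link (?w, t) Y A"
    if Y: "Y \<in> ?S" for Y
  proof -
    have ne: "Y \<noteq> A" "Y \<noteq> A'" "A \<noteq> Y" "A' \<noteq> Y" using Y A A' by auto
    have "count_list ?w Y = 2" using count_list_two[OF g, of Y] Y by simp
    then have "count_list x Y + count_list y Y = 2" using ne by simp
    \<comment> \<open>There are only two types: one that differs from \<open>t A\<close> agrees with
      \<open>t Y\<close> exactly when \<open>t A\<close> does not.\<close>
    moreover have "t' A' = t' Y \<longleftrightarrow> t A \<noteq> t Y" "t' Y = t' A' \<longleftrightarrow> t Y \<noteq> t A"
      using tt Y tA by (metis UnCI letter_type.exhaust Un_iff)+
    ultimately show ?thesis
      using ne A A'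
      by (elim sum_two_cases) (simp_all add: link_def alternate_def filter_pair numeral_2_eq_2)
  qed
  have lXY: "link (?w', t') X Y = link (?w, t) X Y" if "X \<in> ?S" "Y \<in> ?S" for X Y
    using that A A' tt by (intro link_cong) auto
  have S: "set ?w = insert A ?S" "set ?w' = insert A' ?S" by auto
  have n: "n_index (?w, t) X = link (?w, t) X A + (\<Sum>Y\<in>?S. link (?w, t) X Y)"
    and n': "n_index (?w', t') X = link (?w', t') X A' + (\<Sum>Y\<in>?S. link (?w', t') X Y)" for X
    using A A' by (simp_all add: n_index_def)
  have nX: "n_index (?w', t') X = n_index (?w, t) X" if "X \<in> ?S" for X
    unfolding n n' using that by (simp add: lA lXY del: append.simps)
  have nA: "n_index (?w', t') A' = n_index (?w, t) A"
    unfolding n n' by (simp add: lA link_self del: append.simps)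
  show ?thesis
    using A A' by (simp add: odd_index_sum_def S nX nA del: append.simps set_append)
qed

text \<open>Nothing stands between the two copies of \<open>A\<close>, so \<open>A\<close> is linked
  with no letter; the term lost is \<open>h 0\<close>.\<close>

lemma odd_index_sum_H1:
  assumes g: "gauss_word (x @ [A, A] @ y)" and h: "h 0 = 0"
  shows "odd_index_sum h (x @ y, t) = odd_index_sum h (x @ [A, A] @ y, t)"
proof -
  note [[linarith_neq_limit = 0]]
  let ?w = "x @ [A, A] @ y" and ?w' = "x @ y"
  let ?S = "set x \<union> set y"
  have "count_list ?w A = 2" using count_list_two[OF g, of A] by simp
  then have A: "A \<notin> set x" "A \<notin> set y" by (auto simp: count_list_0_iff)
  have lA: "link (?w, t) X A = 0 \<and> link (?w, t) A X = 0" if X: "X \<in> ?S" for X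
  proof -
    have ne: "X \<noteq> A" using X A by auto
    have "count_list ?w X = 2" using count_list_two[OF g, of X] X by simp
    then have "count_list x X + count_list y X = 2" using ne by simp
    then show ?thesis using ne A
      by (elim sum_two_cases) (simp_all add: link_def alternate_def filter_pair numeral_2_eq_2)
  qed
  have lXY: "link (?w', t) X Y = link (?w, t) X Y" if "X \<in> ?S" "Y \<in> ?S" for X Y
    using that A by (intro link_cong) auto
  have S: "set ?w = insert A ?S" "set ?w' = ?S" by auto
  then have n: "n_index (?w, t) X = link (?w, t) X A + (\<Sum>Y\<in>?S. link (?w, t) X Y)"
    and n': "n_index (?w', t) X = (\<Sum>Y\<in>?S. link (?w', t) X Y)" for X
    using A by (simp_all add: n_index_def)
  have nX: "n_index (?w', t) X = n_index (?w, t) X" if "X \<in> ?S" for X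
    unfolding n n' using that by (simp add: lA lXY del: append.simps)
  have nA: "n_index (?w, t) A = 0"
    unfolding n by (simp add: lA link_self del: append.simps)
  show ?thesis
    using A h by (simp add: odd_index_sum_def S nX nA del: append.simps set_append)
qed

text \<open>\<open>A\<close> and \<open>B\<close> are adjacent at both places, so they alternate
  with the same letters in the same order, but with opposite signs as their types differ. Their
  contributions to any other index cancel, their own indices are opposite, and oddness of
  \<open>h\<close> cancels the two lost terms.\<close>

lemma odd_index_sum_H2:
  assumes g: "gauss_word (x @ [A, B] @ y @ [B, A] @ z)"
    and tAB: "t A \<noteq> t B" and h: "\<And>k. h (- k) = - h k"
  shows "odd_index_sum h (x @ y @ z, t) = odd_index_sum h (x @ [A, B] @ y @ [B, A] @ z, t)"
proof -
  note [[linarith_neq_limit = 0]]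
  let ?w = "x @ [A, B] @ y @ [B, A] @ z" and ?w' = "x @ y @ z"
  let ?S = "set x \<union> set y \<union> set z"
  have AB: "A \<noteq> B" using tAB by auto
  have "count_list ?w A = 2" using count_list_two[OF g, of A] by simp
  then have A: "A \<notin> set x" "A \<notin> set y" "A \<notin> set z" using AB by (auto simp: count_list_0_iff)
  have "count_list ?w B = 2" using count_list_two[OF g, of B] by simp
  then have B: "B \<notin> set x" "B \<notin> set y" "B \<notin> set z" using AB by (auto simp: count_list_0_iff)
  have lA: "link (?w, t) X B = - link (?w, t) X A \<and> link (?w, t) B X = - link (?w, t) A X"
    if X: "X \<in> ?S" for X
  proof -
    have ne: "X \<noteq> A" "X \<noteq> B" "A \<noteq> X" "B \<noteq> X" using X A B by auto
    have "count_list ?w X = 2" using count_list_two[OF g, of X] X by simp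
    then have "count_list x X + count_list y X + count_list z X = 2"
      using ne by (simp add: add.assoc)
    moreover have "t B = t X \<longleftrightarrow> t A \<noteq> t X" "t X = t B \<longleftrightarrow> t X \<noteq> t A"
      using tAB by (metis letter_type.exhaust)+
    ultimately show ?thesis using ne A B AB
      by (elim sum_three_cases) (simp_all add: link_def alternate_def filter_pair numeral_2_eq_2)
  qed
  have lAB: "link (?w, t) A B = 0" "link (?w, t) B A = 0"
    using A B AB by (simp_all add: link_def alternate_def filter_pair)
  have lXY: "link (?w', t) X Y = link (?w, t) X Y" if "X \<in> ?S" "Y \<in> ?S" for X Y
    using that A B by (intro link_cong) auto
  have S: "set ?w = insert A (insert B ?S)" "set ?w' = ?S" by auto
  then have n: "n_index (?w, t) X = link (?w, t) X A + link (?w, t) X B + (\<Sum>Y\<in>?S. link (?w, t) X Y)"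
    and n': "n_index (?w', t) X = (\<Sum>Y\<in>?S. link (?w', t) X Y)" for X
    using A B AB by (simp_all add: n_index_def Un_assoc)
  have nX: "n_index (?w', t) X = n_index (?w, t) X" if "X \<in> ?S" for X
    unfolding n n' using that lA[OF that] by (simp add: lXY del: append.simps)
  have nAB: "n_index (?w, t) B = - n_index (?w, t) A"
    unfolding n by (simp add: lAB link_self lA sum_negf del: append.simps)
  show ?thesis
    using A B AB h by (simp add: odd_index_sum_def S nX nAB del: append.simps set_append)
qed

text \<open>Only links among \<open>A\<close>, \<open>B\<close>, \<open>C\<close> change, since each
  swap exchanges two of these letters. Before the move \<open>A\<close> links to \<open>B\<close>
  and \<open>B\<close> to \<open>C\<close>; afterwards only \<open>A\<close> to \<open>C\<close>.
  Either way the three letters contribute 1, 0 and -1 to the indices of \<open>A\<close>,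
  \<open>B\<close> and \<open>C\<close>.\<close>

lemma odd_index_sum_H3:
  assumes g: "gauss_word (x @ [A, B] @ y @ [A, C] @ z @ [B, C] @ u)"
    and tAB: "t A = t B" and tBC: "t B = t C"
  shows "odd_index_sum h (x @ [B, A] @ y @ [C, A] @ z @ [C, B] @ u, t)
    = odd_index_sum h (x @ [A, B] @ y @ [A, C] @ z @ [B, C] @ u, t)"
proof -
  let ?w = "x @ [A, B] @ y @ [A, C] @ z @ [B, C] @ u"
  let ?w' = "x @ [B, A] @ y @ [C, A] @ z @ [C, B] @ u"
  let ?S = "set x \<union> set y \<union> set z \<union> set u"
  have cA: "count_list ?w A = 2" using count_list_two[OF g, of A] by simp
  have cB: "count_list ?w B = 2" using count_list_two[OF g, of B] by simp
  have cC: "count_list ?w C = 2" using count_list_two[OF g, of C] by simp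
  have ne: "A \<noteq> B" "A \<noteq> C" "B \<noteq> C" using cA cB cC by (auto split: if_splits)
  have A: "A \<notin> set x" "A \<notin> set y" "A \<notin> set z" "A \<notin> set u"
    using cA ne by (auto simp: count_list_0_iff)
  have B: "B \<notin> set x" "B \<notin> set y" "B \<notin> set z" "B \<notin> set u"
    using cB ne by (auto simp: count_list_0_iff)
  have C: "C \<notin> set x" "C \<notin> set y" "C \<notin> set z" "C \<notin> set u"
    using cC ne by (auto simp: count_list_0_iff)
  have l2: "link (?w', t) X Y = link (?w, t) X Y" if "X \<in> ?S \<or> Y \<in> ?S" for X Y
    using that A B C by (intro link_cong) auto
  have l3: "link (?w, t) A B = 1" "link (?w, t) A C = 0" "link (?w, t) B A = -1"
     "link (?w, t) B C = 1" "link (?w, t) C A = 0" "link (?w, t) C B = -1"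
    using A B C ne tAB tBC by (simp_all add: link_def alternate_def filter_pair)
  have l4: "link (?w', t) A B = 0" "link (?w', t) A C = 1" "link (?w', t) B A = 0"
     "link (?w', t) B C = 0" "link (?w', t) C A = -1" "link (?w', t) C B = 0"
    using A B C ne tAB tBC by (simp_all add: link_def alternate_def filter_pair)
  have S: "set ?w = insert A (insert B (insert C ?S))" "set ?w' = insert A (insert B (insert C ?S))"
    by auto
  then have n: "n_index (?w, t) X = link (?w, t) X A + link (?w, t) X B + link (?w, t) X C
          + (\<Sum>Y\<in>?S. link (?w, t) X Y)"
    and n': "n_index (?w', t) X = link (?w', t) X A + link (?w', t) X B + link (?w', t) X C
          + (\<Sum>Y\<in>?S. link (?w', t) X Y)" for X
    using A B C ne by (simp_all add: n_index_def)
  have nX: "n_index (?w', t) X = n_index (?w, t) X" if "X \<in> ?S" for X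
    unfolding n n' using that by (simp add: l2 del: append.simps)
  have nABC: "n_index (?w', t) A = n_index (?w, t) A" "n_index (?w', t) B = n_index (?w, t) B"
    "n_index (?w', t) C = n_index (?w, t) C"
    unfolding n n' by (simp_all add: l2 l3 l4 link_self del: append.simps)
  show ?thesis
    using A B C ne by (simp add: odd_index_sum_def S nX nABC del: append.simps set_append)
qed

lemma odd_index_sum_move:
  assumes "move \<alpha> \<beta>" and h: "\<And>k. h (- k) = - h k"
  shows "odd_index_sum h \<beta> = odd_index_sum h \<alpha>"
  using assms(1)
proof (induction rule: move.induct)
  case iso
  then show ?case by (intro odd_index_sum_iso)
next
  case shift
  then show ?case by (intro odd_index_sum_shift)
next
  case H1
  moreover have "h 0 = 0" using h[of 0] by simp
  ultimately show ?case by (intro odd_index_sum_H1)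
next
  case H2
  then show ?case by (intro odd_index_sum_H2 h)
next
  case H3
  then show ?case by (intro odd_index_sum_H3)
qed

lemma odd_index_sum_homotopic:
  assumes "homotopic \<alpha> \<beta>" and h: "\<And>k. h (- k) = - h k"
  shows "odd_index_sum h \<beta> = odd_index_sum h \<alpha>"
proof -
  have "equivclp move \<alpha> \<beta>" using assms(1) by (simp add: homotopic_def)
  then show ?thesis
    by (induction rule: equivclp_induct) (auto dest!: odd_index_sum_move[where h = h, OF _ h])
qed

section \<open>Grid words and their indices\<close>

text \<open>Each block returns reversed, so letters of one block are nested and hence unlinked,
  while a letter of the first block and one of the second alternate, the former coming
  first.\<close>

definition grid_word :: "nat \<Rightarrow> nat \<Rightarrow> nat list" where
  "grid_word p q = [0..<p] @ [p..<p + q] @ rev [0..<p] @ rev [p..<p + q]"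

abbreviation grid :: "nat \<Rightarrow> nat \<Rightarrow> nanoword" where
  "grid p q \<equiv> (grid_word p q, \<lambda>_. Type_a)"

lemma set_grid_word: "set (grid_word p q) = {..<p} \<union> {p..<p + q}"
  by (auto simp: grid_word_def)

lemma count_list_upt: "count_list [m..<n] A = of_bool (m \<le> A \<and> A < n)"
  by (induction n) auto

lemma gauss_grid_word: "gauss_word (grid_word p q)"
  by (auto simp: gauss_word_def grid_word_def count_list_upt)

text \<open>The left side equals its own reversal, whereas \<open>[A, B, A, B]\<close> reverses to
  \<open>[B, A, B, A]\<close>.\<close>

lemma palindrome_not_alternating: "A \<noteq> B \<Longrightarrow> l @ rev l \<noteq> [A, B, A, B]"
  by (metis append_Cons append_Nil list.inject rev.simps rev_append rev_rev_ident)

lemma link_grid: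
  assumes "A < p + q" "B < p + q"
  shows "link (grid p q) A B = of_bool (A < p \<and> p \<le> B) - of_bool (B < p \<and> p \<le> A)"
proof -
  have same: "\<not> alternate (grid_word p q) A B" if "A < p \<longleftrightarrow> B < p" for A B
  proof -
    \<comment> \<open>For two letters on the same side of \<open>p\<close>, one block vanishes under
      the filter and the other leaves a palindrome.\<close>
    have "filter (\<lambda>X. X = A \<or> X = B) [0..<p] = [] \<or> filter (\<lambda>X. X = A \<or> X = B) [p..<p + q] = []"
      using that by (auto simp: filter_empty_conv)
    then show ?thesis
      by (auto simp: alternate_def grid_word_def simp flip: rev_filter
            dest: palindrome_not_alternating)
  qed
  have "filter (\<lambda>X. X = A \<or> X = B) (grid_word p q) = [A, B, A, B]"
    and "filter (\<lambda>X. X = B \<or> X = A) (grid_word p q) = [A, B, A, B]"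
    if "A < p" "p \<le> B" "B < p + q" for A B
    using that by (simp_all add: grid_word_def filter_pair count_list_upt)
  then have "alternate (grid_word p q) A B" "\<not> alternate (grid_word p q) B A"
    if "A < p" "p \<le> B" "B < p + q" for A B
    using that by (auto simp: alternate_def)
  with same assms show ?thesis
    by (cases "A < p"; cases "B < p") (auto simp: link_def)
qed

lemma n_index_grid:
  assumes "X < p + q"
  shows "n_index (grid p q) X = (if X < p then int q else - int p)"
proof -
  have "n_index (grid p q) X = (\<Sum>Y\<in>{..<p}. link (grid p q) X Y) + (\<Sum>Y\<in>{p..<p + q}. link (grid p q) X Y)"
    unfolding n_index_def fst_conv set_grid_word by (rule sum.union_disjoint) auto
  also have "(\<Sum>Y\<in>{..<p}. link (grid p q) X Y) = (if X < p then 0 else - int p)"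
    using assms by (simp add: link_grid)
  also have "(\<Sum>Y\<in>{p..<p + q}. link (grid p q) X Y) = (if X < p then int q else 0)"
    using assms by (simp add: link_grid)
  finally show ?thesis by simp
qed

lemma odd_index_sum_grid:
  "odd_index_sum h (grid p q) = int p * h (int q) + int q * h (- int p)"
proof -
  have "odd_index_sum h (grid p q)
      = (\<Sum>X\<in>{..<p}. h (n_index (grid p q) X)) + (\<Sum>X\<in>{p..<p + q}. h (n_index (grid p q) X))"
    unfolding odd_index_sum_def fst_conv set_grid_word by (rule sum.union_disjoint) auto
  then show ?thesis by (simp add: n_index_grid)
qed

section \<open>Grids fixed by the covering and pairwise not homotopic\<close>

lemma cover_grid:
  assumes "r dvd p" "r dvd q"
  shows "cover r (grid p q) = grid p q"
proof -
  have "int r dvd n_index (grid p q) X" if "X \<in> set (grid_word p q)" for X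
    using that assms by (auto simp: n_index_grid set_grid_word)
  then show ?thesis by (simp add: cover_def)
qed

lemma homotopic_grid_iff:
  assumes "0 < p" "p \<noteq> q" "p \<noteq> q'"
  shows "homotopic (grid p q) (grid p q') \<longleftrightarrow> q = q'"
proof
  \<comment> \<open>This is the simplest odd function supported at \<open>p\<close> and
    \<open>- p\<close>. As \<open>q\<close> is neither, only the \<open>q\<close> letters of index
    \<open>- p\<close> count, and the invariant is \<open>- q\<close>.\<close>
  define h :: "int \<Rightarrow> int" where "h k = of_bool (k = int p) - of_bool (k = - int p)" for k
  have "h (- k) = - h k" for k
    by (simp add: h_def minus_equation_iff eq_commute)
  moreover assume "homotopic (grid p q) (grid p q')"
  ultimately have "odd_index_sum h (grid p q') = odd_index_sum h (grid p q)"
    by (intro odd_index_sum_homotopic)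
  then show "q = q'"
    using assms by (simp add: odd_index_sum_grid h_def)
qed (simp add: homotopic_def gauss_grid_word)

theorem theorem7p3:
  fixes r :: nat
  assumes "r > 1"
  shows "infinite {\<Gamma> :: virtual_string. covering r \<Gamma> = \<Gamma>}"
proof -
  \<comment> \<open>The offset 2 keeps \<open>q\<close> away from \<open>p = r\<close>, where the
    two terms of the invariant would cancel.\<close>
  define F where "F k = abs_virtual_string (grid r (r * (k + 2)))" for k
  \<comment> \<open>\<open>homotopic\<close> is only a partial equivalence: passing between classes
    and representatives requires the grids to lie in its domain.\<close>
  have refl: "homotopic (grid p q) (grid p q)" for p q
    by (simp add: homotopic_def gauss_grid_word)
  have "inj F"
  proof (rule injI)
    fix j k
    assume "F j = F k"
    then have "homotopic (grid r (r * (j + 2))) (grid r (r * (k + 2)))"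
      using refl Quotient3_rel[OF Quotient3_virtual_string] by (metis F_def)
    then show "j = k"
      using assms by (subst (asm) homotopic_grid_iff) auto
  qed
  moreover have "covering r (F k) = F k" for k
    by (simp add: F_def covering.abs_eq refl cover_grid)
  ultimately show ?thesis
    by (metis (mono_tags, lifting) infinite_iff_countable_subset image_subsetI mem_Collect_eq)
qed

end
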